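(* For any fixed real number $\omega > \frac{1}{2}$, $$\lim_{N \rightarrow \infty} N^{1/2} \sum_{k=1}^{\lfloor \omega \log N \rfloor} \frac{H_k(N)}{2^{k-1} k!} = 2 \pi^{-1/2}; \qquad \lim_{N \rightarrow \infty} N^{1/2} \sum_{k=1}^{\lfloor \omega \log N \rfloor} \frac{Z_k(N)}{2^{k-1} k!} = 2^{3/2} \pi^{-1/2}.$$
   Context: For integers $m \ge k \ge 1$, let $\mathcal{C}_k(m)$ be the set of $k$-tuples $\mathbf{a} = (a_1, \ldots, a_k)$ of positive integers with $\sum_i a_i = m$, and define $$H_k(m) = \sum_{\mathbf{a} \in \mathcal{C}_k(m)} \prod_{i=1}^k \frac{1}{a_i}; \qquad Z_k(m) = \sum_{\mathbf{a} \in \mathcal{C}_k(m)} \prod_{i=1}^k \frac{\zeta(2a_i)}{a_i},$$ where $\zeta$ is the Riemann zeta function. *)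

theory Defs
  imports "HOL-Analysis.Analysis"
begin

(* k-tuples are lists of length k. The set is empty for m < k. *)
definition compositions :: "nat \<Rightarrow> nat \<Rightarrow> nat list set" where
  "compositions k m = {a. length a = k \<and> (\<forall>x\<in>set a. 0 < x) \<and> sum_list a = m}"

lemma finite_compositions: "finite (compositions k m)"
proof (rule finite_subset)
  show "compositions k m \<subseteq> {a. set a \<subseteq> {..m} \<and> length a = k}"
    by (auto simp: compositions_def intro: member_le_sum_list)
  show "finite {a. set a \<subseteq> {..m} \<and> length a = k}"
    by (rule finite_lists_length_eq) simp
qed

(* The Riemann zeta function on real arguments s > 1, where its Dirichlet series converges;
   for s <= 1 the value is not meaningful (no analytic continuation is attempted). *)
definition zeta :: "real \<Rightarrow> real" where
  "zeta s = (\<Sum>n. 1 / real (Suc n) powr s)"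

lemma summable_zeta:
  assumes "s > 1"
  shows "summable (\<lambda>n. 1 / real (Suc n) powr s)"
proof -
  have "summable (\<lambda>n. real n powr - s)"
    using assms by (simp add: summable_real_powr_iff)
  hence "summable (\<lambda>n. real (Suc n) powr - s)"
    by (subst summable_Suc_iff)
  thus ?thesis
    by (simp only: powr_minus_divide)
qed

definition H :: "nat \<Rightarrow> nat \<Rightarrow> real" where
  "H k m = (\<Sum>a\<in>compositions k m. \<Prod>i<k. 1 / real (a ! i))"

definition Z :: "nat \<Rightarrow> nat \<Rightarrow> real" where
  "Z k m = (\<Sum>a\<in>compositions k m. \<Prod>i<k. zeta (2 * real (a ! i)) / real (a ! i))"

end

theory Submission
  imports Defs "HOL-Computational_Algebra.Formal_Power_Series"
begin

text \<open>
  Let w be the weight of a part and W(x) its generating function, so that the weighted sums over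
  compositions are the coefficients of the powers of W, and the untruncated sums over k are
  coefficients of 2 exp(W(x)/2).  In both cases w(a) = 1/a + e(a) with e(a) \<ge> 0 decaying
  geometrically (e(a) = 0 for H, e(a) = (\<zeta>(2a) - 1)/a for Z), so that
  exp(s W(x)) = (1 - x)^(-s) exp(s E(x)), where E is the generating function of e.
  The coefficients of the first factor are asymptotic to N^(s-1)/\<Gamma>(s), and convolution with
  those of the second multiplies this by exp(s E(1)).  Here E(1) = 0 for H; for Z, E(1) is the
  sum of -ln(1 - 1/n^2) over n \<ge> 2, which telescopes to ln 2.  The tail k > \<omega> ln N is
  at most u^(-\<omega> ln N) times the N-th coefficient of exp(u W(x)/2) for every u > 1, which is
  o(N^(-1/2)) as soon as (u - 1)/2 < \<omega> ln u; such a u exists near 1 because \<omega> > 1/2.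
\<close>

unbundle no vec_syntax
unbundle fps_syntax

section \<open>Evaluating series with nonnegative coefficients\<close>

text \<open>Tonelli for series. It serves twice: to evaluate exp(s E(x)) at a point, and to sum the
  zeta values.\<close>

lemma sums_swap_nonneg:
  fixes f :: "nat \<Rightarrow> nat \<Rightarrow> real"
  assumes nn: "\<And>i j. f i j \<ge> 0"
    and rows: "\<And>i. f i sums g i" and cols: "\<And>j. (\<lambda>i. f i j) sums h j"
    and "g sums S"
  shows "h sums S"
proof -
  have g0: "g i \<ge> 0" for i
    using sums_le[OF _ sums_zero rows] nn by blast
  have gS: "(g has_sum S) UNIV"
    by (intro sums_nonneg_imp_has_sum assms g0)
  have row: "((\<lambda>j. (\<lambda>(i,j). f i j) (i, j)) has_sum g i) UNIV" for i
    using sums_nonneg_imp_has_sum[OF rows nn] by simp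
  have "(\<lambda>(i,j). f i j) summable_on (UNIV \<times> UNIV)"
    by (rule summable_on_SigmaI[OF row]) (use gS nn in \<open>auto simp: summable_on_def\<close>)
  with row gS have "((\<lambda>(i,j). f i j) has_sum S) (UNIV \<times> UNIV)"
    by (intro has_sum_SigmaI) auto
  then have 1: "((\<lambda>(j,i). f i j) has_sum S) (UNIV \<times> UNIV)"
    by (subst (asm) has_sum_swap) simp
  have "(h has_sum S) UNIV"
    by (rule has_sum_SigmaD[OF 1]) (use sums_nonneg_imp_has_sum[OF cols nn] in simp)
  then show ?thesis by (rule has_sum_imp_sums)
qed

lemma fps_power_nth_nonneg:
  fixes E :: "real fps"
  assumes "\<And>n. E $ n \<ge> 0"
  shows "(E ^ k) $ n \<ge> 0"
  by (induction k arbitrary: n) (auto simp: fps_mult_nth intro!: sum_nonneg mult_nonneg_nonneg assms)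

lemma sums_fps_power:
  fixes E :: "real fps"
  assumes nn: "\<And>n. E $ n \<ge> 0" and "r \<ge> 0" and E: "(\<lambda>n. E $ n * r ^ n) sums L"
  shows "(\<lambda>n. (E ^ k) $ n * r ^ n) sums (L ^ k)"
proof (induction k)
  case 0
  have "(\<lambda>n. if n = 0 then 1 else 0::real) sums 1" by (rule sums_single[of 0 "\<lambda>_. 1"])
  then show ?case by (simp add: if_distrib[of "\<lambda>x. x * _"] cong: if_cong)
next
  case (Suc k)
  have 1: "summable (\<lambda>n. norm (E $ n * r ^ n))" "summable (\<lambda>n. norm ((E ^ k) $ n * r ^ n))"
    using E Suc nn fps_power_nth_nonneg[OF nn] \<open>r \<ge> 0\<close> by (simp_all add: sums_iff)
  from Cauchy_product_sums[OF this]
  have "(\<lambda>n. \<Sum>i\<le>n. (E $ i * r ^ i) * ((E ^ k) $ (n - i) * r ^ (n - i))) sums (L * L ^ k)"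
    using E Suc by (simp add: sums_iff)
  moreover have "(\<Sum>i\<le>n. (E $ i * r ^ i) * ((E ^ k) $ (n - i) * r ^ (n - i))) = (E ^ Suc k) $ n * r ^ n" for n
    by (auto simp: fps_mult_nth sum_distrib_right atMost_atLeast0 simp flip: power_add intro!: sum.cong)
  ultimately show ?case by simp
qed

text \<open>Expand the exponential as the sum over k of s^k E^k / k! and exchange it with the sum
  over n. Since \<open>E $ 0 = 0\<close>, the sum over k is finite for each n.\<close>

lemma sums_fps_exp_compose:
  fixes E :: "real fps"
  assumes nn: "\<And>n. E $ n \<ge> 0" and E0: "E $ 0 = 0" and s: "s \<ge> 0" and r: "r \<ge> 0"
    and E: "(\<lambda>n. E $ n * r ^ n) sums L"
  shows "(\<lambda>n. (fps_exp s oo E) $ n * r ^ n) sums exp (s * L)"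
proof (rule sums_swap_nonneg)
  show "0 \<le> s ^ k / fact k * ((E ^ k) $ n * r ^ n)" for k n
    using s r fps_power_nth_nonneg[OF nn] by simp
  show "(\<lambda>n. s ^ k / fact k * ((E ^ k) $ n * r ^ n)) sums (s ^ k / fact k * L ^ k)" for k
    by (intro sums_mult sums_fps_power assms)
  show "(\<lambda>k. s ^ k / fact k * ((E ^ k) $ n * r ^ n)) sums ((fps_exp s oo E) $ n * r ^ n)" for n
  proof -
    have "(\<lambda>k. s ^ k / fact k * ((E ^ k) $ n * r ^ n))
        sums (\<Sum>k\<in>{0..n}. s ^ k / fact k * ((E ^ k) $ n * r ^ n))"
      using E0 by (intro sums_finite) (auto simp: startsby_zero_power_prefix)
    then show ?thesis
      by (simp add: fps_compose_nth sum_distrib_left sum_distrib_right mult_ac)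
  qed
  show "(\<lambda>k. s ^ k / fact k * L ^ k) sums exp (s * L)"
    using exp_converges[of "s * L"] by (simp add: power_mult_distrib divide_inverse mult_ac)
qed

section \<open>Exponentials of formal power series\<close>

text \<open>Both sides solve Y' = s (A + B)' Y with constant coefficient 1. Hence their quotient
  \<open>Q\<close> has derivative 0 and constant coefficient 1.\<close>

lemma fps_exp_compose_add:
  fixes A B :: "real fps"
  assumes "A $ 0 = 0" "B $ 0 = 0"
  shows "fps_exp s oo (A + B) = (fps_exp s oo A) * (fps_exp s oo B)"
proof -
  define F where "F = (\<lambda>A. fps_exp s oo A)"
  have unit: "F A $ 0 = 1" for A by (simp add: F_def)
  have dF: "fps_deriv (F A) = fps_const s * F A * fps_deriv A" if "A $ 0 = 0" for A
    using that by (simp add: F_def fps_compose_deriv fps_compose_mult_distrib)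
  define Q where "Q = F (A + B) * inverse (F A * F B)"
  have FAB: "(F A * F B) $ 0 \<noteq> 0" by (simp add: unit)
  have d: "fps_deriv (F A * F B) = fps_const s * (F A * F B) * fps_deriv (A + B)"
    using assms by (simp add: dF algebra_simps)
  have d2: "fps_deriv (F (A + B)) = fps_const s * F (A + B) * fps_deriv (A + B)"
    using assms by (intro dF) simp
  define G I D where "G = F A * F B" and "I = inverse (F A * F B)" and "D = fps_deriv (A + B)"
  have IG: "I * G = 1"
    unfolding G_def I_def by (rule inverse_mult_eq_1[OF FAB])
  have "fps_deriv Q = fps_const s * F (A + B) * D * I + F (A + B) * - (fps_const s * G * D) * I ^ 2"
    unfolding Q_def G_def I_def D_def
    by (simp only: fps_deriv_mult[of "F (A + B)"] d2 fps_inverse_deriv[OF FAB] d) (simp add: mult_ac)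
  also have "\<dots> = fps_const s * F (A + B) * D * I * (1 - I * G)"
    by (simp add: algebra_simps power2_eq_square)
  finally have "fps_deriv Q = 0" by (simp only: IG) simp
  then have "Q = fps_const (Q $ 0)"
    by (rule iffD1[OF fps_deriv_eq_0_iff])
  also have "Q $ 0 = 1" by (simp add: Q_def unit)
  finally have "Q * (F A * F B) = F A * F B" by (simp only: fps_const_1_eq_1 mult_1_left)
  moreover have "Q * (F A * F B) = F (A + B)"
    unfolding Q_def using inverse_mult_eq_1[OF FAB] by (simp add: mult.assoc)
  ultimately show ?thesis by (simp only: F_def)
qed

text \<open>The inner series is -ln(1 - x), its constant term being 0 because
  \<open>1 / 0 = 0\<close>. The composition F therefore satisfies (1 - x) F' = s F, and comparing
  coefficients gives the recursion of (1 - x)^(-s).\<close>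

lemma fps_exp_compose_neg_log:
  fixes s :: real
  shows "(fps_exp s oo Abs_fps (\<lambda>n. 1 / real n)) $ n = pochhammer s n / fact n"
proof -
  define A where "A = Abs_fps (\<lambda>n. 1 / real n)"
  define F where "F = fps_exp s oo A"
  have "fps_deriv A * (1 - fps_X) = 1"
    by (rule fps_ext) (simp add: A_def right_diff_distrib)
  moreover have "fps_deriv F = fps_const s * F * fps_deriv A"
    by (simp add: F_def A_def fps_compose_deriv fps_compose_mult_distrib)
  ultimately have ode: "fps_deriv F * (1 - fps_X) = fps_const s * F"
    by (simp add: mult.assoc)
  have rec: "real (Suc n) * F $ Suc n = (s + real n) * F $ n" for n
    using arg_cong[OF ode, of "\<lambda>f. f $ n"] by (cases n) (simp_all add: right_diff_distrib, simp_all add: algebra_simps)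
  have "F $ n = pochhammer s n / fact n"
  proof (induction n)
    case 0
    then show ?case by (simp add: F_def)
  next
    case (Suc n)
    have "F $ Suc n = (s + real n) * F $ n / real (Suc n)"
      using rec[of n] by (simp add: field_simps del: of_nat_Suc)
    then show ?case by (simp add: Suc pochhammer_Suc divide_simps mult_ac)
  qed
  then show ?thesis by (simp add: F_def A_def)
qed

section \<open>Asymptotics of coefficients\<close>

lemma pochhammer_asymptotic:
  fixes s :: real
  shows "(\<lambda>n. real n powr (1 - s) * (pochhammer s n / fact n)) \<longlonglongrightarrow> inverse (Gamma s)"
proof (rule Lim_transform_eventually)
  show "(\<lambda>n. ((-s) gchoose n) / ((-1) ^ n / exp ((- s + 1) * of_real (ln (real n))))) \<longlonglongrightarrow> inverse (Gamma s)"
    using gbinomial_asymptotic[of "-s"] by simp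
  show "\<forall>\<^sub>F n in sequentially. ((-s) gchoose n) / ((-1) ^ n / exp ((- s + 1) * of_real (ln (real n)))) =
      real n powr (1 - s) * (pochhammer s n / fact n)"
    using eventually_gt_at_top[of 0]
  proof eventually_elim
    case (elim n)
    then show ?case by (simp add: gbinomial_pochhammer powr_def algebra_simps flip: power_mult_distrib)
  qed
qed

text \<open>Dominated convergence in the form of Tannery's theorem: each fixed j contributes
  \<open>g j * c\<close> in the limit, and N / (N - j + 1) \<le> j + 1 \<le> 2^j gives a majorant of
  the form C g(j) 2^j.\<close>

lemma convolution_asymptotic:
  fixes p g :: "nat \<Rightarrow> real"
  assumes s: "0 \<le> s" "s \<le> 1"
    and p: "(\<lambda>n. real n powr (1 - s) * p n) \<longlonglongrightarrow> c"
    and g: "\<And>j. g j \<ge> 0" "g sums G" "summable (\<lambda>j. g j * 2 ^ j)"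
  shows "(\<lambda>N. real N powr (1 - s) * (\<Sum>j\<le>N. g j * p (N - j))) \<longlonglongrightarrow> G * c"
proof -
  \<comment> \<open>The shifted weight n + 1 keeps control of \<open>p 0\<close>, which occurs for j
    = N; the weight \<open>real 0 powr (1 - s)\<close> would be 0 there.\<close>
  define q where "q = (\<lambda>n. real (Suc n) powr (1 - s) * p n)"
  have "(\<lambda>n. (real (Suc n) / real n) powr (1 - s) * (real n powr (1 - s) * p n)) \<longlonglongrightarrow> 1 powr (1 - s) * c"
    by (intro tendsto_mult tendsto_powr p LIMSEQ_Suc_n_over_n tendsto_const) auto
  moreover have "\<forall>\<^sub>F n in sequentially. (real (Suc n) / real n) powr (1 - s) * (real n powr (1 - s) * p n) = q n"
    using eventually_gt_at_top[of 0] by eventually_elim (simp add: q_def powr_divide)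
  ultimately have q: "q \<longlonglongrightarrow> c"
    by (auto dest: Lim_transform_eventually)
  then have "Bseq q" by (intro convergent_imp_Bseq convergentI)
  then obtain C where C: "C > 0" "\<And>n. \<bar>q n\<bar> \<le> C" by (auto simp: Bseq_def)
  have pq: "real N powr (1 - s) * p n = (real N / real (Suc n)) powr (1 - s) * q n" for N n
    by (simp add: q_def powr_divide)
  \<comment> \<open>Extension by 0 beyond j = N turns the finite convolution into a series over all
    j.\<close>
  define a where "a = (\<lambda>j N. if j \<le> N then g j * (real N powr (1 - s) * p (N - j)) else 0)"
  have lim: "a j \<longlonglongrightarrow> g j * c" for j
  proof (rule LIMSEQ_offset)
    have "(\<lambda>n. 1 + (real j - 1) * inverse (real (Suc n))) \<longlonglongrightarrow> 1 + (real j - 1) * 0"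
      by (intro tendsto_intros LIMSEQ_inverse_real_of_nat)
    moreover have "1 + (real j - 1) * inverse (real (Suc n)) = real (n + j) / real (Suc n)" for n
      by (simp add: field_simps)
    ultimately have "(\<lambda>n. real (n + j) / real (Suc n)) \<longlonglongrightarrow> 1" by simp
    then have "(\<lambda>n. g j * ((real (n + j) / real (Suc n)) powr (1 - s) * q n)) \<longlonglongrightarrow> g j * (1 powr (1 - s) * c)"
      by (intro tendsto_mult tendsto_powr q tendsto_const) auto
    then show "(\<lambda>n. a j (n + j)) \<longlonglongrightarrow> g j * c"
      by (simp add: a_def pq del: of_nat_Suc of_nat_add)
  qed
  have bound: "norm (a j N) \<le> C * (g j * 2 ^ j)" for j N
  proof (cases "j \<le> N")
    case True
    have "N \<le> (j + 1) * Suc (N - j)"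
      using le_Suc_ex[OF True] by auto
    then have "real N \<le> real (j + 1) * real (Suc (N - j))"
      by (metis of_nat_le_iff of_nat_mult)
    then have "(real N / real (Suc (N - j))) powr (1 - s) \<le> real (j + 1) powr (1 - s)"
      using s by (intro powr_mono2) (simp_all add: field_simps)
    also have "\<dots> \<le> real (j + 1) powr 1"
      using s by (intro powr_mono) auto
    also have "\<dots> \<le> 2 ^ j"
      using of_nat_mono[OF Suc_leI[OF less_exp[of j]], where 'a = real] by simp
    finally have "(real N / real (Suc (N - j))) powr (1 - s) * \<bar>q (N - j)\<bar> \<le> 2 ^ j * C"
      using C by (intro mult_mono) auto
    then have "g j * ((real N / real (Suc (N - j))) powr (1 - s) * \<bar>q (N - j)\<bar>) \<le> g j * (2 ^ j * C)"
      using g by (intro mult_left_mono)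
    moreover have "a j N = g j * ((real N / real (Suc (N - j))) powr (1 - s) * q (N - j))"
      using True by (simp add: a_def pq del: of_nat_Suc)
    ultimately show ?thesis
      using g(1)[of j] by (simp add: abs_mult mult_ac del: of_nat_Suc)
  next
    case False
    then show ?thesis using C g(1)[of j] by (simp add: a_def)
  qed
  have "(\<lambda>N. \<Sum>j. a j N) \<longlonglongrightarrow> (\<Sum>j. g j * c)"
    using tannerys_theorem[where a = a and M = "\<lambda>j. C * (g j * 2 ^ j)", OF lim] g(3) bound
    by (auto simp: summable_mult case_prod_unfold)
  also have "(\<Sum>j. g j * c) = G * c"
    using sums_mult2[OF g(2), of c] by (simp add: sums_iff)
  also have "(\<lambda>N. \<Sum>j. a j N) = (\<lambda>N. real N powr (1 - s) * (\<Sum>j\<le>N. g j * p (N - j)))"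
  proof
    fix N
    have "(\<Sum>j. a j N) = (\<Sum>j\<le>N. a j N)"
      by (intro suminf_finite) (auto simp: a_def)
    then show "(\<Sum>j. a j N) = real N powr (1 - s) * (\<Sum>j\<le>N. g j * p (N - j))"
      by (simp add: a_def sum_distrib_left mult_ac)
  qed
  finally show ?thesis .
qed

lemma fps_exp_compose_asymptotic:
  fixes E :: "real fps"
  assumes E: "\<And>n. E $ n \<ge> 0" "E $ 0 = 0" "(\<lambda>n. E $ n) sums L" "summable (\<lambda>n. E $ n * 2 ^ n)"
    and s: "0 \<le> s" "s \<le> 1"
  shows "(\<lambda>N. real N powr (1 - s) * (fps_exp s oo (Abs_fps (\<lambda>n. 1 / real n) + E)) $ N)
    \<longlonglongrightarrow> exp (s * L) * inverse (Gamma s)"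
proof -
  let ?g = "\<lambda>j. (fps_exp s oo E) $ j"
  have g: "?g j \<ge> 0" for j
    using s fps_power_nth_nonneg[OF E(1)] by (simp add: fps_compose_nth sum_nonneg)
  \<comment> \<open>Evaluation at 1 produces the factor exp(s L) of the limit; evaluation at 2
    produces the majorant for the convolution.\<close>
  have sums: "?g sums exp (s * L)"
    using sums_fps_exp_compose[OF E(1,2) s(1), of 1 L] E(3) by simp
  have summ: "summable (\<lambda>j. ?g j * 2 ^ j)"
    using sums_fps_exp_compose[OF E(1,2) s(1), of 2] E(4)[THEN summable_sums] by (auto simp: sums_iff)
  have "(fps_exp s oo (Abs_fps (\<lambda>n. 1 / real n) + E)) $ N
      = (\<Sum>j\<le>N. ?g j * (pochhammer s (N - j) / fact (N - j)))" for N
    using E(2) by (subst add.commute)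
      (simp add: fps_exp_compose_add fps_mult_nth fps_exp_compose_neg_log atMost_atLeast0)
  then show ?thesis
    using convolution_asymptotic[OF s pochhammer_asymptotic g sums summ] by simp
qed

section \<open>Truncating the sum over k\<close>

lemma truncated_fps_exp_compose_asymptotic:
  fixes E :: "real fps" and \<omega> :: real
  assumes E: "\<And>n. E $ n \<ge> 0" "E $ 0 = 0" "(\<lambda>n. E $ n) sums L" "summable (\<lambda>n. E $ n * 2 ^ n)"
    and \<omega>: "\<omega> > 1 / 2"
  defines "W \<equiv> Abs_fps (\<lambda>n. 1 / real n) + E"
  shows "(\<lambda>N. real N powr (1 / 2) *
            (\<Sum>k = 1..nat \<lfloor>\<omega> * ln (real N)\<rfloor>. (W ^ k) $ N / (2 ^ (k - 1) * fact k)))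
          \<longlonglongrightarrow> 2 * (exp (L / 2) * pi powr (- 1 / 2))"
proof -
  define F where "F = (\<lambda>s N. (fps_exp s oo W) $ N)"
  define t where "t = (\<lambda>s N k. s ^ k / fact k * (W ^ k) $ N)"
  define P where "P = (\<lambda>N. \<Sum>k = 1..nat \<lfloor>\<omega> * ln (real N)\<rfloor>. t (1/2) N k)"
  have F_eq: "F s N = (\<Sum>k = 0..N. t s N k)" for s N
    by (simp add: F_def t_def fps_compose_nth)
  have asym: "(\<lambda>N. real N powr (1 - s) * F s N) \<longlonglongrightarrow> exp (s * L) * inverse (Gamma s)"
    if "0 \<le> s" "s \<le> 1" for s
    unfolding F_def W_def by (intro fps_exp_compose_asymptotic E that)
  have W: "W $ n \<ge> 0" "W $ 0 = 0" for n
    using E(1)[of n] E(2) by (simp_all add: W_def)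
  have t_nonneg: "t s N k \<ge> 0" if "s \<ge> 0" for s N k
    using that fps_power_nth_nonneg[OF W(1)] by (simp add: t_def)
  have t_0: "t s N k = 0" if "k > N" for s N k
    using that W(2) by (simp add: t_def startsby_zero_power_prefix)

  \<comment> \<open>The function \<open>f\<close> vanishes at 1 with slope \<omega> - 1/2 > 0, so it
    is positive just to the right of 1. The bound u < 2 keeps s = u/2 within the range of
    \<open>asym\<close>.\<close>
  obtain u where u: "1 < u" "u < 2" "(u - 1) / 2 < \<omega> * ln u"
  proof -
    define f where "f = (\<lambda>u. \<omega> * ln u - (u - 1) / 2)"
    have "(f has_real_derivative (\<omega> - 1 / 2)) (at 1)"
      unfolding f_def by (auto intro!: derivative_eq_intros)
    from DERIV_pos_inc_right[OF this] obtain d where d: "d > 0" "\<And>h. 0 < h \<Longrightarrow> h < d \<Longrightarrow> f 1 < f (1 + h)"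
      using \<omega> by auto
    define h where "h = min (d / 2) (1 / 2)"
    have "f 1 < f (1 + h)" "0 < h" "h < 1"
      using d(1) by (auto simp: h_def intro!: d(2))
    then show ?thesis
      by (intro that[of "1 + h"]) (simp_all add: f_def)
  qed

  \<comment> \<open>Rankin's trick: for k above the cutoff, u^k \<ge> u^(\<omega> ln N) =
    N^(\<omega> ln u), so each tail term may be multiplied by u^k N^(-\<omega> ln u) \<ge> 1. The
    factor u^k turns s = 1/2 into s = u/2.\<close>
  have tail: "\<bar>F (1/2) N - P N\<bar> \<le> real N powr (- (\<omega> * ln u)) * F (u/2) N" if N: "N > 0" for N
  proof -
    define K where "K = nat \<lfloor>\<omega> * ln (real N)\<rfloor>"
    \<comment> \<open>The term k = 0 vanishes for N > 0, and the terms k > N vanish because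
      \<open>W\<close> has no constant term. So it does not matter that \<open>P\<close> starts at 1
      and that \<open>K\<close> may exceed N.\<close>
    have t0: "t s N 0 = 0" for s using N by (simp add: t_def)
    have "P N = (\<Sum>k\<in>{k. k \<le> N \<and> k \<le> K}. t (1/2) N k)"
      unfolding P_def K_def[symmetric]
      by (intro sum.mono_neutral_cong) (auto simp: t_0 t0 not_le)
    moreover have "F (1/2) N = (\<Sum>k\<in>{k. k \<le> N \<and> k \<le> K} \<union> {k. k \<le> N \<and> k > K}. t (1/2) N k)"
      unfolding F_eq by (intro sum.cong) auto
    moreover have "\<dots> = (\<Sum>k\<in>{k. k \<le> N \<and> k \<le> K}. t (1/2) N k) + (\<Sum>k\<in>{k. k \<le> N \<and> k > K}. t (1/2) N k)"
      by (intro sum.union_disjoint) auto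
    ultimately have diff: "F (1/2) N - P N = (\<Sum>k\<in>{k. k \<le> N \<and> k > K}. t (1/2) N k)"
      by simp
    have t_le: "t (1/2) N k \<le> real N powr (- (\<omega> * ln u)) * t (u/2) N k" if "k > K" for k
    proof -
      have "\<omega> * ln (real N) \<le> real k"
        using that by (simp add: K_def) linarith
      then have "u powr (\<omega> * ln (real N)) \<le> u powr real k"
        using u by (intro powr_mono) auto
      moreover have "u powr (\<omega> * ln (real N)) = real N powr (\<omega> * ln u)"
        using u N by (simp add: powr_def)
      ultimately have "1 \<le> real N powr (- (\<omega> * ln u)) * u ^ k"
        using u N by (simp add: powr_minus powr_realpow divide_simps)
      then have "t (1/2) N k * 1 \<le> t (1/2) N k * (real N powr (- (\<omega> * ln u)) * u ^ k)"
        by (intro mult_left_mono t_nonneg) auto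
      also have "\<dots> = real N powr (- (\<omega> * ln u)) * t (u/2) N k"
        by (simp add: t_def power_divide)
      finally show ?thesis by simp
    qed
    have "(\<Sum>k\<in>{k. k \<le> N \<and> k > K}. t (1/2) N k) \<le> (\<Sum>k\<in>{k. k \<le> N \<and> k > K}. real N powr (- (\<omega> * ln u)) * t (u/2) N k)"
      by (intro sum_mono t_le) auto
    also have "\<dots> \<le> (\<Sum>k = 0..N. real N powr (- (\<omega> * ln u)) * t (u/2) N k)"
      using u by (intro sum_mono2) (auto intro!: t_nonneg mult_nonneg_nonneg)
    also have "\<dots> = real N powr (- (\<omega> * ln u)) * F (u/2) N"
      by (simp add: F_eq sum_distrib_left)
    moreover have "0 \<le> (\<Sum>k\<in>{k. k \<le> N \<and> k > K}. t (1/2) N k)"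
      by (intro sum_nonneg t_nonneg) auto
    ultimately show ?thesis by (simp add: diff)
  qed

  \<comment> \<open>As F(u/2) is of order at most N^(u/2 - 1), the error times N^(1/2) is of order
    at most N^((u - 1)/2 - \<omega> ln u), and the choice of u makes this exponent negative.\<close>
  have neg: "(u - 1) / 2 - \<omega> * ln u < 0" using u by simp
  have "((\<lambda>N. real N powr ((u - 1) / 2 - \<omega> * ln u) * (real N powr (1 - u/2) * F (u/2) N))
    \<longlonglongrightarrow> 0 * (exp (u/2 * L) * inverse (Gamma (u/2))))"
    using u by (intro tendsto_mult asym tendsto_neg_powr[OF neg filterlim_real_sequentially]) auto
  then have "(\<lambda>N. real N powr ((u - 1) / 2 - \<omega> * ln u) * (real N powr (1 - u/2) * F (u/2) N)) \<longlonglongrightarrow> 0"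
    by simp
  moreover have "\<forall>\<^sub>F N in sequentially. norm (real N powr (1/2) * (F (1/2) N - P N))
      \<le> real N powr ((u - 1) / 2 - \<omega> * ln u) * (real N powr (1 - u/2) * F (u/2) N)"
    using eventually_gt_at_top[of 0]
  proof eventually_elim
    case (elim N)
    have "norm (real N powr (1/2) * (F (1/2) N - P N))
        \<le> real N powr (1/2) * (real N powr (- (\<omega> * ln u)) * F (u/2) N)"
      using tail[OF elim] by (simp add: abs_mult mult_left_mono)
    also have "\<dots> = real N powr ((u - 1) / 2 - \<omega> * ln u) * (real N powr (1 - u/2) * F (u/2) N)"
      by (simp add: mult.assoc[symmetric] powr_add[symmetric]) (simp add: field_simps)
    finally show ?case .
  qed
  ultimately have "(\<lambda>N. real N powr (1/2) * (F (1/2) N - P N)) \<longlonglongrightarrow> 0"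
    by (rule Lim_null_comparison[rotated])
  from tendsto_diff[OF asym[of "1/2"] this]
  have "(\<lambda>N. real N powr (1/2) * P N) \<longlonglongrightarrow> exp (L / 2) * inverse (Gamma (1/2))"
    by (simp add: algebra_simps)
  moreover have "inverse (Gamma (1/2)) = pi powr (- 1 / 2)"
    by (simp add: Gamma_one_half_real powr_minus powr_half_sqrt)
  ultimately have "(\<lambda>N. 2 * (real N powr (1/2) * P N)) \<longlonglongrightarrow> 2 * (exp (L / 2) * pi powr (- 1 / 2))"
    by (intro tendsto_mult[OF tendsto_const]) simp
  moreover have "2 * (real N powr (1/2) * P N) = real N powr (1 / 2) *
      (\<Sum>k = 1..nat \<lfloor>\<omega> * ln (real N)\<rfloor>. (W ^ k) $ N / (2 ^ (k - 1) * fact k))" for N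
  proof -
    \<comment> \<open>This needs k \<ge> 1, since k - 1 is truncated subtraction.\<close>
    have "2 * t (1/2) N k = (W ^ k) $ N / (2 ^ (k - 1) * fact k)" if "k \<ge> 1" for k
      using that by (cases k) (simp_all add: t_def power_divide)
    then show ?thesis
      by (simp add: P_def sum_distrib_left mult.left_commute[of 2])
  qed
  ultimately show ?thesis by simp
qed

section \<open>Compositions as coefficients of powers\<close>

text \<open>The power formula runs over \<open>natpermute m k\<close>, which also admits zero
  entries; \<open>w 0 = 0\<close> removes their contribution.\<close>

lemma Abs_fps_power_nth_compositions:
  fixes w :: "nat \<Rightarrow> real"
  assumes "w 0 = 0"
  shows "(Abs_fps w ^ k) $ m = (\<Sum>a\<in>compositions k m. \<Prod>i<k. w (a ! i))"
proof (cases k)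
  case 0
  have "compositions 0 m = (if m = 0 then {[]} else {})"
    by (auto simp: compositions_def)
  then show ?thesis using 0 by simp
next
  case (Suc l)
  have "(Abs_fps w ^ k) $ m = (\<Sum>a\<in>natpermute m k. \<Prod>i<k. w (a ! i))"
    by (simp add: Suc fps_power_nth_Suc lessThan_Suc_atMost atMost_atLeast0 del: power_Suc)
  also have "\<dots> = (\<Sum>a\<in>compositions k m. \<Prod>i<k. w (a ! i))"
  proof (rule sum.mono_neutral_right)
    show "\<forall>a\<in>natpermute m k - compositions k m. (\<Prod>i<k. w (a ! i)) = 0"
    proof
      fix a assume a: "a \<in> natpermute m k - compositions k m"
      then have "0 \<in> set a" "length a = k"
        by (auto simp: natpermute_def compositions_def)
      then obtain i where "i < k" "a ! i = 0" by (auto simp: in_set_conv_nth)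
      then show "(\<Prod>i<k. w (a ! i)) = 0" using assms by (intro prod_zero) (auto intro!: bexI[of _ i])
    qed
  qed (auto simp: natpermute_finite, auto simp: natpermute_def compositions_def)
  finally show ?thesis .
qed

section \<open>Zeta values at even integers\<close>

text \<open>Writing the terms as a-th powers of 1/n^2, n \<ge> 2, prepares for the logarithm series
  in a.\<close>

lemma zeta_even_minus_one_sums:
  assumes "a > 0"
  shows "(\<lambda>i. (1 / real (i + 2) ^ 2) ^ a) sums (zeta (2 * real a) - 1)"
proof -
  have "(\<lambda>n. 1 / real (Suc n) powr (2 * real a)) sums zeta (2 * real a)"
    unfolding zeta_def using assms by (intro summable_sums summable_zeta) simp
  moreover have "1 / real (Suc n) powr (2 * real a) = (1 / real (Suc n) ^ 2) ^ a" for n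
    using powr_realpow[of "real (Suc n)" "2 * a"] by (simp add: power_mult power_one_over)
  ultimately have "(\<lambda>n. (1 / real (Suc n) ^ 2) ^ a) sums zeta (2 * real a)"
    by simp
  then show ?thesis
    using sums_Suc_iff[of "\<lambda>n. (1 / real (Suc n) ^ 2) ^ a" "zeta (2 * real a) - 1"] by simp
qed

text \<open>With n = i + 2, 1 - 1/n^2 = (n - 1)(n + 1) / n^2, so the terms are differences of
  consecutive values of ln(n / (n - 1)), which starts at ln 2 and tends to 0.\<close>

lemma sums_neg_ln_one_minus_inverse_squares:
  "(\<lambda>i. - ln (1 - 1 / real (i + 2) ^ 2)) sums ln 2"
proof -
  define h where "h = (\<lambda>i. ln (real (Suc (Suc i)) / real (Suc i)))"
  have "(\<lambda>i. real (Suc (Suc i)) / real (Suc i)) \<longlonglongrightarrow> 1"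
    using LIMSEQ_Suc[OF LIMSEQ_Suc_n_over_n] .
  then have "h \<longlonglongrightarrow> ln 1"
    unfolding h_def by (intro tendsto_ln) auto
  from telescope_sums'[OF this] have "(\<lambda>i. h i - h (Suc i)) sums ln 2"
    by (simp add: h_def)
  moreover have "h i - h (Suc i) = - ln (1 - 1 / real (i + 2) ^ 2)" for i
  proof -
    have "h i - h (Suc i) = ln ((real (Suc (Suc i)) / real (Suc i)) / (real (Suc (Suc (Suc i))) / real (Suc (Suc i))))"
      unfolding h_def by (subst (3) ln_div) auto
    also have "(real (Suc (Suc i)) / real (Suc i)) / (real (Suc (Suc (Suc i))) / real (Suc (Suc i)))
      = inverse (1 - 1 / real (i + 2) ^ 2)"
    proof -
      have "1 - 1 / real (i + 2) ^ 2 = real (Suc i) * real (Suc (Suc (Suc i))) / real (i + 2) ^ 2"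
      proof -
        define y where "y = real (i + 2)"
        have "y > 0" and eqs: "real (Suc i) = y - 1" "real (Suc (Suc (Suc i))) = y + 1"
          by (simp_all add: y_def)
        from this(1) show ?thesis
          unfolding y_def[symmetric] eqs by (simp add: field_simps power2_eq_square)
      qed
      then show ?thesis
        by (simp add: power2_eq_square del: of_nat_Suc)
    qed
    also have "ln \<dots> = - ln (1 - 1 / real (i + 2) ^ 2)"
      by (rule ln_inverse)
    finally show ?thesis .
  qed
  ultimately show ?thesis by simp
qed

text \<open>Expand zeta(2a) - 1 over n \<ge> 2 and sum over a first: each n yields the series of
  -ln(1 - 1/n^2). The terms with a = 0 are 0 by division by zero.\<close>

lemma sums_zeta_even_minus_one:
  "(\<lambda>a. (zeta (2 * real a) - 1) / real a) sums ln 2"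
proof (rule sums_swap_nonneg)
  show "(1 / real (i + 2) ^ 2) ^ a / real a \<ge> 0" for i a by simp
  show "(\<lambda>a. (1 / real (i + 2) ^ 2) ^ a / real a) sums (- ln (1 - 1 / real (i + 2) ^ 2))" for i
  proof -
    have "(1::real) < real (i + 2) ^ 2" by (rule one_less_power) auto
    then have "\<bar>- (1 / real (i + 2) ^ 2)\<bar> < 1" by simp
    from sums_minus[OF ln_series'[OF this]] show ?thesis by simp
  qed
  show "(\<lambda>i. (1 / real (i + 2) ^ 2) ^ a / real a) sums ((zeta (2 * real a) - 1) / real a)" for a
    using sums_divide[OF zeta_even_minus_one_sums[of a]] by (cases "a = 0") auto
qed (rule sums_neg_ln_one_minus_inverse_squares)

lemma zeta_even_ge_one:
  assumes "a > 0"
  shows "zeta (2 * real a) \<ge> 1"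
  using sums_le[OF _ sums_zero zeta_even_minus_one_sums[OF assms]] by simp

text \<open>One factor 1/n^2 is kept for convergence, and the other a - 1 factors are at most 1/4
  because n \<ge> 2.\<close>

lemma zeta_even_minus_one_le:
  assumes "a > 0"
  shows "zeta (2 * real a) - 1 \<le> (1 / 4) ^ (a - 1) * (zeta 2 - 1)"
proof (rule sums_le[OF _ zeta_even_minus_one_sums[OF assms]])
  show "(\<lambda>i. (1 / 4) ^ (a - 1) * (1 / real (i + 2) ^ 2)) sums ((1 / 4) ^ (a - 1) * (zeta 2 - 1))"
    using sums_mult[OF zeta_even_minus_one_sums[of 1]] by simp
  show "(1 / real (i + 2) ^ 2) ^ a \<le> (1 / 4) ^ (a - 1) * (1 / real (i + 2) ^ 2)" for i
  proof -
    have "(2::real) ^ 2 \<le> real (i + 2) ^ 2" by (rule power_mono) auto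
    then have "1 / real (i + 2) ^ 2 \<le> 1 / 4" by (intro divide_left_mono) auto
    then have "(1 / real (i + 2) ^ 2) ^ (a - 1) \<le> (1 / 4) ^ (a - 1)" by (rule power_mono) simp
    then have "(1 / real (i + 2) ^ 2) ^ (a - 1) * (1 / real (i + 2) ^ 2) \<le> (1 / 4) ^ (a - 1) * (1 / real (i + 2) ^ 2)"
      by (rule mult_right_mono) simp
    then show ?thesis using assms by (cases a) (simp_all add: mult_ac)
  qed
qed

text \<open>The decay 4^(-a) beats the weight 2^a, leaving a geometric series of ratio 1/2.\<close>

lemma summable_zeta_even_minus_one:
  "summable (\<lambda>a. (zeta (2 * real a) - 1) / real a * 2 ^ a)"
proof (rule summable_comparison_test)
  show "\<exists>M. \<forall>a\<ge>M. norm ((zeta (2 * real a) - 1) / real a * 2 ^ a) \<le> 4 * (zeta 2 - 1) * (1 / 2) ^ a"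
  proof (intro exI allI impI)
    fix a :: nat assume "a \<ge> 1"
    then have a: "a > 0" by simp
    have "(zeta (2 * real a) - 1) / real a \<le> (zeta (2 * real a) - 1) / 1"
      using zeta_even_ge_one[OF a] a by (intro divide_left_mono) auto
    also have "\<dots> \<le> (1 / 4) ^ (a - 1) * (zeta 2 - 1)"
      using zeta_even_minus_one_le[OF a] by simp
    finally have "(zeta (2 * real a) - 1) / real a * 2 ^ a \<le> (1 / 4) ^ (a - 1) * (zeta 2 - 1) * 2 ^ a"
      by (rule mult_right_mono) simp
    also have "\<dots> = 4 * (zeta 2 - 1) * (1 / 2) ^ a"
    proof -
      have "(1 / 4 :: real) ^ (a - 1) * 2 ^ a = 4 * ((1 / 4) ^ a * 2 ^ a)"
        using a by (cases a) auto
      also have "(1 / 4 :: real) ^ a * 2 ^ a = (1 / 2) ^ a"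
        by (simp flip: power_mult_distrib)
      finally have "(1 / 4 :: real) ^ (a - 1) * 2 ^ a = 4 * (1 / 2) ^ a" .
      from arg_cong[OF this, of "\<lambda>x. x * (zeta 2 - 1)"] show ?thesis by (simp only: mult_ac)
    qed
    finally show "norm ((zeta (2 * real a) - 1) / real a * 2 ^ a) \<le> 4 * (zeta 2 - 1) * (1 / 2) ^ a"
      using zeta_even_ge_one[OF a] by simp
  qed
qed (intro summable_mult summable_geometric, simp)

section \<open>The limits for \<open>H\<close> and \<open>Z\<close>\<close>

theorem proposition6p4:
  fixes \<omega> :: real
  assumes "\<omega> > 1 / 2"
  shows "(\<lambda>N::nat. real N powr (1 / 2) *
            (\<Sum>k = 1..nat \<lfloor>\<omega> * ln (real N)\<rfloor>. H k N / (2 ^ (k - 1) * fact k)))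
          \<longlonglongrightarrow> 2 * pi powr (- 1 / 2)
       \<and> (\<lambda>N::nat. real N powr (1 / 2) *
            (\<Sum>k = 1..nat \<lfloor>\<omega> * ln (real N)\<rfloor>. Z k N / (2 ^ (k - 1) * fact k)))
          \<longlonglongrightarrow> 2 powr (3 / 2) * pi powr (- 1 / 2)"
proof
  let ?A = "Abs_fps (\<lambda>n. 1 / real n)"
  \<comment> \<open>The harmonic weights are the case E = 0, L = 0.\<close>
  have H: "((?A + 0) ^ k) $ N = H k N" for k N
    by (simp add: H_def Abs_fps_power_nth_compositions)
  show "(\<lambda>N::nat. real N powr (1 / 2) *
            (\<Sum>k = 1..nat \<lfloor>\<omega> * ln (real N)\<rfloor>. H k N / (2 ^ (k - 1) * fact k)))
          \<longlonglongrightarrow> 2 * pi powr (- 1 / 2)"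
    using truncated_fps_exp_compose_asymptotic[of 0 0 \<omega>] assms unfolding H by simp
  \<comment> \<open>At a = 0 all weights are 0 by division by zero, whatever the value of
    \<open>zeta 0\<close>.\<close>
  define E where "E = Abs_fps (\<lambda>a. (zeta (2 * real a) - 1) / real a)"
  have "?A + E = Abs_fps (\<lambda>a. zeta (2 * real a) / real a)"
    by (rule fps_ext) (simp add: E_def diff_divide_distrib)
  then have Z: "((?A + E) ^ k) $ N = Z k N" for k N
    by (simp add: Z_def Abs_fps_power_nth_compositions)
  have E_nonneg: "E $ n \<ge> 0" for n
    using zeta_even_ge_one[of n] by (cases "n = 0") (simp_all add: E_def)
  have "exp (ln 2 / 2) = (2::real) powr (1 / 2)"
    by (simp add: powr_def)
  then have const: "2 * (exp (ln 2 / 2) * pi powr (- 1 / 2)) = 2 powr (3 / 2) * pi powr (- 1 / 2)"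
    using powr_add[of "2::real" 1 "1 / 2"] by simp
  show "(\<lambda>N::nat. real N powr (1 / 2) *
            (\<Sum>k = 1..nat \<lfloor>\<omega> * ln (real N)\<rfloor>. Z k N / (2 ^ (k - 1) * fact k)))
          \<longlonglongrightarrow> 2 powr (3 / 2) * pi powr (- 1 / 2)"
    using truncated_fps_exp_compose_asymptotic[OF E_nonneg _ _ _ assms, of "ln 2"]
      sums_zeta_even_minus_one summable_zeta_even_minus_one
    unfolding Z const by (simp add: E_def)
qed

end
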